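(* Let $1<p<\infty$ and $\alpha,\beta\in\mathbb{R}$ with $\alpha<\beta$. Let $A:L_p(\mathbb{R})\to L_p(\mathbb{R})$ and $B:L_p(\mathbb{R})\to L_p(\mathbb{R})$ be defined, for almost all $t$, by $$(Ax)(t)=a(t)x(t),\qquad (Bx)(t)=\int_{\alpha}^{\beta}k(t,s)x(s)\,ds,$$ where $a:\mathbb{R}\to\mathbb{R}$ and $k:\mathbb{R}\times[\alpha,\beta]\to\mathbb{R}$ are measurable functions. Consider a polynomial $F(z)=\sum_{j=0}^{n}\delta_jz^j$ with $\delta_0,\ldots,\delta_n\in\mathbb{R}$. Then $AB=BF(A)$ if and only if the set $$\operatorname{supp}\bigl(a(t)-F(a(s))\bigr)\cap\operatorname{supp}k(t,s)$$ has measure zero in $\mathbb{R}\times[\alpha,\beta]$.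
   Context: $L_p(\mathbb{R})$ is the real Banach space of (classes of almost everywhere equal) measurable functions $f:\mathbb{R}\to\mathbb{R}$ with $\int|f|^p<\infty$, with Lebesgue measure. Writing $A:L_p(\mathbb{R})\to L_p(\mathbb{R})$ means that the operator $A$ given by the formula is assumed to be well defined from $L_p(\mathbb{R})$ to $L_p(\mathbb{R})$; likewise for $B$. For a polynomial $F(z)=\sum_{j=0}^n\delta_jz^j$, $F(A)=\delta_0I+\sum_{j=1}^n\delta_jA^j$, where $I$ is the identity operator. For a function $f(t,s)$ of $(t,s)\in\mathbb{R}\times[\alpha,\beta]$, $\operatorname{supp}f(t,s)=\{(t,s)\in\mathbb{R}\times[\alpha,\beta]: f(t,s)\neq0\}$ (no closure is taken). Measure on $\mathbb{R}\times[\alpha,\beta]$ is two-dimensional Lebesgue measure. *)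

theory Defs
  imports "HOL-Analysis.Analysis" "HOL-Computational_Algebra.Polynomial"
begin

definition ae_eq :: "(real \<Rightarrow> real) \<Rightarrow> (real \<Rightarrow> real) \<Rightarrow> bool" where
  "ae_eq f g \<longleftrightarrow> f \<in> borel_measurable lebesgue \<and> g \<in> borel_measurable lebesgue
     \<and> (AE t in lebesgue. f t = g t)"

lemma ae_eq_part_equivp: "part_equivp ae_eq"
proof (rule part_equivpI)
  show "\<exists>f. ae_eq f f" by (rule exI[of _ "\<lambda>_. 0"]) (simp add: ae_eq_def)
  show "symp ae_eq" by (auto simp: symp_def ae_eq_def eq_commute)
  show "transp ae_eq"
  proof (rule transpI)
    fix f g h assume "ae_eq f g" "ae_eq g h"
    then show "ae_eq f h" unfolding ae_eq_def by (auto elim: AE_mp)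
  qed
qed

text \<open>The quotient is partial: \<open>ae_eq f f\<close> holds iff \<open>f\<close> is Lebesgue measurable, so the
  elements of \<open>mfun\<close> are the classes of almost everywhere equal measurable functions.
  The exponent \<open>p\<close> cannot be a parameter of a type; the spaces \<open>L\<^sub>p\<close> are linear subspaces
  of this single real vector space.\<close>

quotient_type mfun = "real \<Rightarrow> real" / partial: ae_eq
  morphisms repr ae_class
  by (rule ae_eq_part_equivp)

instantiation mfun :: real_vector
begin

lift_definition zero_mfun :: mfun is "\<lambda>_. 0"
  by (simp add: ae_eq_def)

lift_definition plus_mfun :: "mfun \<Rightarrow> mfun \<Rightarrow> mfun" is "\<lambda>f g t. f t + g t"
  unfolding ae_eq_def by auto

lift_definition minus_mfun :: "mfun \<Rightarrow> mfun \<Rightarrow> mfun" is "\<lambda>f g t. f t - g t"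
  unfolding ae_eq_def by auto

lift_definition uminus_mfun :: "mfun \<Rightarrow> mfun" is "\<lambda>f t. - f t"
  unfolding ae_eq_def by auto

lift_definition scaleR_mfun :: "real \<Rightarrow> mfun \<Rightarrow> mfun" is "\<lambda>c f t. c * f t"
  unfolding ae_eq_def by auto

instance
  by standard (transfer; auto simp: ae_eq_def algebra_simps)+

end

text \<open>\<open>repr x\<close> is one (measurable) representative of the class \<open>x\<close>; membership in \<open>Lp p\<close> does
  not depend on which one is chosen.\<close>

definition Lp :: "real \<Rightarrow> mfun set" where
  "Lp p = {x. integrable lebesgue (\<lambda>t. \<bar>repr x t\<bar> powr p)}"

definition poly_op :: "real poly \<Rightarrow> ('a::real_vector \<Rightarrow> 'a) \<Rightarrow> 'a \<Rightarrow> 'a" where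
  "poly_op F A x = (\<Sum>j\<le>degree F. coeff F j *\<^sub>R (A ^^ j) x)"

end

theory Submission
  imports Defs
begin

text \<open>
  Applying both sides of \<open>AB = BF(A)\<close> to \<open>x\<close> and subtracting gives, for almost every \<open>t\<close>,
  the integral of \<open>k(t,s) (a(t) - F(a(s))) x(s)\<close> over \<open>s \<in> [\<alpha>,\<beta>]\<close> (\<open>commutator_kernel\<close>). So the
  relation says that the integral operator with kernel \<open>c(t,s) = k(t,s) (a(t) - F(a(s)))\<close>
  vanishes on \<open>L\<^sub>p\<close>, and the set in the theorem is the set of points of the strip where
  \<open>c \<noteq> 0\<close>.

  By Fubini, that set is null iff for almost every \<open>t\<close> the section \<open>c(t,\<cdot>)\<close> vanishes almost
  everywhere (\<open>null_set_iff_sections_null\<close>); in this case the operator clearly vanishes. The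
  converse has to cope with the exceptional null set of \<open>t\<close>, which depends on \<open>x\<close>. Hence only
  countably many test functions are used, namely the indicators of \<open>[\<alpha>,\<beta>]\<close> and of
  \<open>[\<alpha>,\<beta>] \<inter> (-\<infinity>,q]\<close> for rational \<open>q\<close>: outside one null set of \<open>t\<close> all integrals of
  \<open>c(t,\<cdot>)\<close> over these sets are zero. The rational half-lines form a generator of the Borel
  sets that is closed under intersection, so the integrals of \<open>c(t,\<cdot>)\<close> over all Borel sets vanish, and
  \<open>c(t,\<cdot>) = 0\<close> almost everywhere (\<open>AE_zero_if_integral_atMost_zero\<close>).
\<close>

section \<open>Classes of measurable functions\<close>

lemma repr_measurable: "repr x \<in> borel_measurable lebesgue"
  using Quotient3_rep_reflp[OF Quotient3_mfun, of x] by (simp add: ae_eq_def)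

lemma mfun_eq_iff: "x = y \<longleftrightarrow> (AE t in lebesgue. repr x t = repr y t)"
  using Quotient3_rel_rep[OF Quotient3_mfun, of x y] repr_measurable by (simp add: ae_eq_def)

lemma repr_ae_class:
  assumes "f \<in> borel_measurable lebesgue"
  shows "AE t in lebesgue. repr (ae_class f) t = f t"
  using Quotient3_rep_abs[OF Quotient3_mfun, of f] assms by (simp add: ae_eq_def)

lemma ae_class_repr: "ae_class (repr x) = x"
  by (rule Quotient3_abs_rep[OF Quotient3_mfun])

lemma repr_add: "AE t in lebesgue. repr (x + y) t = repr x t + repr y t"
proof -
  have "x + y = ae_class (\<lambda>t. repr x t + repr y t)"
    using plus_mfun.abs_eq[of "repr x" "repr y"] repr_measurable
    by (simp add: ae_class_repr ae_eq_def)
  then show ?thesis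
    using repr_ae_class[of "\<lambda>t. repr x t + repr y t"] repr_measurable by simp
qed

lemma repr_scaleR: "AE t in lebesgue. repr (c *\<^sub>R x) t = c * repr x t"
proof -
  have "c *\<^sub>R x = ae_class (\<lambda>t. c * repr x t)"
    using scaleR_mfun.abs_eq[of "repr x" c] repr_measurable
    by (simp add: ae_class_repr ae_eq_def)
  then show ?thesis
    using repr_ae_class[of "\<lambda>t. c * repr x t"] repr_measurable by simp
qed

lemma repr_zero: "AE t in lebesgue. repr 0 t = 0"
  using repr_ae_class[of "\<lambda>_. 0"] by (simp add: zero_mfun.abs_eq)

lemma repr_sum:
  assumes "finite I"
  shows "AE t in lebesgue. repr (\<Sum>i\<in>I. x i) t = (\<Sum>i\<in>I. repr (x i) t)"
  using assms
proof induction
  case empty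
  then show ?case using repr_zero by simp
next
  case (insert i I)
  show ?case
    using insert.IH repr_add[of "x i" "\<Sum>i\<in>I. x i"]
    by eventually_elim (simp add: insert.hyps)
qed

lemma Lp_zero: "0 \<in> Lp p"
proof -
  have "integrable lebesgue (\<lambda>t. \<bar>repr 0 t\<bar> powr p)"
  proof (rule integrable_cong_AE_imp)
    show "integrable lebesgue (\<lambda>t. 0 :: real)" by simp
    show "(\<lambda>t. \<bar>repr 0 t\<bar> powr p) \<in> borel_measurable lebesgue"
      using repr_measurable by measurable
    show "AE t in lebesgue. 0 = \<bar>repr 0 t\<bar> powr p"
      using repr_zero by eventually_elim simp
  qed
  then show ?thesis by (simp add: Lp_def)
qed

lemma Lp_scaleR:
  assumes "x \<in> Lp p"
  shows "c *\<^sub>R x \<in> Lp p"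
proof -
  have "integrable lebesgue (\<lambda>t. \<bar>repr (c *\<^sub>R x) t\<bar> powr p) \<longleftrightarrow>
        integrable lebesgue (\<lambda>t. \<bar>c\<bar> powr p * \<bar>repr x t\<bar> powr p)"
    using repr_scaleR[of c x] repr_measurable
    by (intro integrable_cong_AE) (auto elim: eventually_mono simp: abs_mult powr_mult)
  then show ?thesis using assms by (simp add: Lp_def)
qed

text \<open>From \<open>\<bar>u + v\<bar> \<le> 2 max \<bar>u\<bar> \<bar>v\<bar>\<close> one gets
  \<open>\<bar>u + v\<bar>\<^sup>p \<le> 2\<^sup>p (\<bar>u\<bar>\<^sup>p + \<bar>v\<bar>\<^sup>p)\<close>, hence an integrable bound.\<close>

lemma Lp_add:
  assumes p: "0 \<le> p" and x: "x \<in> Lp p" and y: "y \<in> Lp p"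
  shows "x + y \<in> Lp p"
proof -
  have bound: "\<bar>u + v\<bar> powr p \<le> 2 powr p * (\<bar>u\<bar> powr p + \<bar>v\<bar> powr p)" for u v :: real
  proof -
    have "\<bar>u + v\<bar> powr p \<le> (2 * max \<bar>u\<bar> \<bar>v\<bar>) powr p"
      using p by (intro powr_mono2) auto
    also have "\<dots> = 2 powr p * max \<bar>u\<bar> \<bar>v\<bar> powr p" by (simp add: powr_mult)
    also have "\<dots> \<le> 2 powr p * (\<bar>u\<bar> powr p + \<bar>v\<bar> powr p)"
      by (intro mult_left_mono) (auto simp: max_def)
    finally show ?thesis .
  qed
  have "integrable lebesgue (\<lambda>t. \<bar>repr (x + y) t\<bar> powr p)"
  proof (rule Bochner_Integration.integrable_bound)
    show "integrable lebesgue (\<lambda>t. 2 powr p * (\<bar>repr x t\<bar> powr p + \<bar>repr y t\<bar> powr p))"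
      using x y by (simp add: Lp_def)
    show "(\<lambda>t. \<bar>repr (x + y) t\<bar> powr p) \<in> borel_measurable lebesgue"
      using repr_measurable by measurable
    show "AE t in lebesgue. norm (\<bar>repr (x + y) t\<bar> powr p)
            \<le> norm (2 powr p * (\<bar>repr x t\<bar> powr p + \<bar>repr y t\<bar> powr p))"
      using repr_add[of x y] by eventually_elim (simp add: bound)
  qed
  then show ?thesis by (simp add: Lp_def)
qed

lemma Lp_sum:
  assumes "0 \<le> p" "finite I" "\<And>i. i \<in> I \<Longrightarrow> x i \<in> Lp p"
  shows "(\<Sum>i\<in>I. x i) \<in> Lp p"
  using assms(2,3) by induction (auto intro: Lp_zero Lp_add assms(1))

lemma indicator_in_Lp:
  assumes "S \<in> lmeasurable"
  shows "ae_class (indicator S) \<in> Lp p"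
proof -
  have S: "S \<in> sets lebesgue" using assms by auto
  have "integrable lebesgue (\<lambda>t. \<bar>repr (ae_class (indicator S)) t\<bar> powr p) \<longleftrightarrow>
        integrable lebesgue (indicator S :: real \<Rightarrow> real)"
    using repr_ae_class[of "indicator S"] repr_measurable S
    by (intro integrable_cong_AE) (auto elim!: eventually_mono simp: indicator_def)
  also have "\<dots>" using assms by (simp add: fmeasurable_def integrable_indicator_iff del: emeasure_completion)
  finally show ?thesis by (simp add: Lp_def)
qed

section \<open>Polynomials in a multiplication operator\<close>

text \<open>The membership part is carried along because the formula for \<open>A\<close> is available on
  \<open>Lp p\<close> only.\<close>

lemma mult_op_funpow:
  assumes A: "A \<in> Lp p \<rightarrow> Lp p"
    and mult: "\<And>x. x \<in> Lp p \<Longrightarrow> AE t in lebesgue. repr (A x) t = a t * repr x t"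
    and x: "x \<in> Lp p"
  shows "(A ^^ j) x \<in> Lp p \<and> (AE t in lebesgue. repr ((A ^^ j) x) t = a t ^ j * repr x t)"
proof (induction j)
  case 0
  then show ?case using x by simp
next
  case (Suc j)
  then have "AE t in lebesgue. repr ((A ^^ Suc j) x) t = a t * repr ((A ^^ j) x) t"
    using mult by simp
  with Suc have "AE t in lebesgue. repr ((A ^^ Suc j) x) t = a t ^ Suc j * repr x t"
    by (auto elim: AE_mp)
  then show ?case using Suc A by auto
qed

lemma poly_op_mult_op:
  assumes p: "0 \<le> p" and A: "A \<in> Lp p \<rightarrow> Lp p"
    and mult: "\<And>x. x \<in> Lp p \<Longrightarrow> AE t in lebesgue. repr (A x) t = a t * repr x t"
    and x: "x \<in> Lp p"
  shows "poly_op F A x \<in> Lp p"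
    and "AE t in lebesgue. repr (poly_op F A x) t = poly F (a t) * repr x t"
proof -
  have pow: "(A ^^ j) x \<in> Lp p \<and> (AE t in lebesgue. repr ((A ^^ j) x) t = a t ^ j * repr x t)" for j
    by (rule mult_op_funpow[OF A mult x])
  show "poly_op F A x \<in> Lp p"
    unfolding poly_op_def using pow by (intro Lp_sum Lp_scaleR) (auto simp: p)
  have "AE t in lebesgue. \<forall>j\<in>{..degree F}.
      repr (coeff F j *\<^sub>R (A ^^ j) x) t = coeff F j * (a t ^ j * repr x t)"
  proof (rule AE_finite_allI)
    fix j
    show "AE t in lebesgue. repr (coeff F j *\<^sub>R (A ^^ j) x) t = coeff F j * (a t ^ j * repr x t)"
      using conjunct2[OF pow[of j]] repr_scaleR[of "coeff F j" "(A ^^ j) x"]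
      by eventually_elim simp
  qed simp
  moreover have "AE t in lebesgue. repr (poly_op F A x) t =
      (\<Sum>j\<le>degree F. repr (coeff F j *\<^sub>R (A ^^ j) x) t)"
    unfolding poly_op_def by (rule repr_sum) simp
  ultimately show "AE t in lebesgue. repr (poly_op F A x) t = poly F (a t) * repr x t"
    by eventually_elim (simp add: poly_altdef sum_distrib_right mult.assoc)
qed

section \<open>Null sets of the plane and their sections\<close>

text \<open>Borel measurability of the projections does not suffice for composing them with Lebesgue
  measurable functions; one also needs that preimages of null sets are null, which holds because
  the preimage of \<open>N\<close> under a projection is a cylinder over \<open>N\<close>, of measure \<open>0 \<cdot> \<infinity> = 0\<close>.\<close>

lemma measurable_fst_lebesgue:
  "fst \<in> (lebesgue :: ('a::euclidean_space \<times> 'b::euclidean_space) measure) \<rightarrow>\<^sub>M lebesgue"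
proof (rule completion.measurable_completion2)
  show meas: "fst \<in> (lebesgue :: ('a \<times> 'b) measure) \<rightarrow>\<^sub>M lborel"
    by (intro measurable_completion) (simp flip: borel_prod)
  show "null_sets lborel \<subseteq> null_sets (distr (lebesgue :: ('a \<times> 'b) measure) lborel fst)"
  proof
    fix N :: "'a set"
    assume N: "N \<in> null_sets lborel"
    then have "N \<times> (UNIV :: 'b set) \<in> null_sets lborel"
      by (auto simp: null_sets_def lborel.emeasure_pair_measure_Times simp flip: lborel_prod)
    then have "N \<times> (UNIV :: 'b set) \<in> null_sets lebesgue" by (rule null_sets_completionI)
    then show "N \<in> null_sets (distr (lebesgue :: ('a \<times> 'b) measure) lborel fst)"
      using null_setsD2[OF N] meas by (simp add: null_sets_distr_iff fst_vimage_eq_Times)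
  qed
qed

lemma measurable_snd_lebesgue:
  "snd \<in> (lebesgue :: ('a::euclidean_space \<times> 'b::euclidean_space) measure) \<rightarrow>\<^sub>M lebesgue"
proof (rule completion.measurable_completion2)
  show meas: "snd \<in> (lebesgue :: ('a \<times> 'b) measure) \<rightarrow>\<^sub>M lborel"
    by (intro measurable_completion) (simp flip: borel_prod)
  show "null_sets lborel \<subseteq> null_sets (distr (lebesgue :: ('a \<times> 'b) measure) lborel snd)"
  proof
    fix N :: "'b set"
    assume N: "N \<in> null_sets lborel"
    then have "(UNIV :: 'a set) \<times> N \<in> null_sets lborel"
      by (auto simp: null_sets_def lborel.emeasure_pair_measure_Times simp flip: lborel_prod)
    then have "(UNIV :: 'a set) \<times> N \<in> null_sets lebesgue" by (rule null_sets_completionI)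
    then show "N \<in> null_sets (distr (lebesgue :: ('a \<times> 'b) measure) lborel snd)"
      using null_setsD2[OF N] meas by (simp add: null_sets_distr_iff snd_vimage_eq_Times)
  qed
qed

text \<open>Fubini's theorem for the uncompleted product, transferred to the completion. For the
  direction from the sections to \<open>S\<close>, it is applied to a Borel subset of \<open>S\<close> that exhausts \<open>S\<close>
  up to a null set.\<close>

lemma null_set_iff_sections_null:
  fixes S :: "('a::euclidean_space \<times> 'b::euclidean_space) set"
  assumes "S \<in> sets lebesgue"
  shows "S \<in> null_sets lebesgue \<longleftrightarrow> (AE t in lebesgue. AE s in lebesgue. (t, s) \<notin> S)"
proof
  assume "S \<in> null_sets lebesgue"
  then have "AE z in lborel. z \<notin> S"
    using AE_not_in AE_completion_iff by blast
  then have "AE t in lborel. AE s in lborel. (t, s) \<notin> S"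
    by (intro lborel_pair.AE_pair[where Q = "\<lambda>z. z \<notin> S"]) (simp only: lborel_prod)
  then show "AE t in lebesgue. AE s in lebesgue. (t, s) \<notin> S"
    by (simp add: AE_completion_iff)
next
  assume *: "AE t in lebesgue. AE s in lebesgue. (t, s) \<notin> S"
  obtain T N N' where S: "S = T \<union> N" and N: "N \<subseteq> N'" "N' \<in> null_sets lborel"
      and T: "T \<in> sets (lborel :: ('a \<times> 'b) measure)"
    using assms by (rule sets_completionE)
  have "AE t in lborel. AE s in lborel. (t, s) \<notin> S"
    using * by (simp add: AE_completion_iff)
  then have "AE t in lborel. AE s in lborel. (t, s) \<notin> T"
    by (rule eventually_mono) (auto elim: eventually_mono simp: S)
  moreover have "{z \<in> space (lborel \<Otimes>\<^sub>M lborel). z \<notin> T} \<in> sets (lborel \<Otimes>\<^sub>M lborel)"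
    unfolding lborel_prod using T by (simp add: borel_comp flip: Compl_eq)
  ultimately have "AE z in lborel \<Otimes>\<^sub>M lborel. z \<notin> T"
    by (intro lborel_pair.AE_pair_measure)
  then have "AE z in lborel. z \<notin> T" by (simp only: lborel_prod)
  then have "T \<in> null_sets lborel"
    using T by (simp add: AE_iff_null_sets)
  then have "T \<union> N' \<in> null_sets lborel" using N by auto
  then show "S \<in> null_sets lebesgue"
    unfolding null_sets_completion_iff2 using N S by blast
qed

section \<open>Functions with vanishing integrals over rational half-lines\<close>

lemma borel_eq_sigma_rational_atMost:
  "sets (borel :: real measure) = sigma_sets UNIV ((\<lambda>q. {..q}) ` \<rat>)"
proof
  let ?G = "(\<lambda>q::real. {..q}) ` \<rat>"
  show "sigma_sets UNIV ?G \<subseteq> sets borel"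
    by (rule sets.sigma_sets_subset'[of _ borel, simplified]) auto
  interpret sigma_algebra UNIV "sigma_sets UNIV ?G"
    by (rule sigma_algebra_sigma_sets) auto
  have "{..c} \<in> sigma_sets UNIV ?G" for c :: real
  proof -
    have eq: "{..c} = (\<Inter>q \<in> {q \<in> \<rat>. c < q}. {..q})"
    proof (intro equalityI subsetI)
      fix u assume u: "u \<in> (\<Inter>q \<in> {q \<in> \<rat>. c < q}. {..q})"
      show "u \<in> {..c}"
      proof (rule ccontr)
        assume "u \<notin> {..c}"
        then obtain q where "q \<in> \<rat>" "c < q" "q < u" using Rats_dense_in_real[of c u] by auto
        with u show False by auto
      qed
    qed auto
    obtain q where "q \<in> \<rat>" "c < q" using Rats_dense_in_real[of c "c + 1"] by auto
    then show ?thesis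
      unfolding eq by (intro countable_INT') (auto intro: countable_subset[OF _ countable_rat])
  qed
  then show "sets borel \<subseteq> sigma_sets UNIV ?G"
    unfolding borel_eq_atMost
    by (subst sets_measure_of) (auto intro!: sigma_sets_mono)
qed

text \<open>After replacing \<open>f\<close> by an almost everywhere equal Borel function, Dynkin's
  \<open>\<pi>\<close>-\<open>\<lambda>\<close> argument extends the vanishing of the integral from rational half-lines to all Borel
  sets. The total integral enters in the step for complements, as \<open>UNIV\<close> is not one of the
  half-lines.\<close>

lemma AE_zero_if_integral_atMost_zero:
  fixes f :: "real \<Rightarrow> real"
  assumes f: "integrable lebesgue f" and total: "(LINT s|lebesgue. f s) = 0"
    and half: "\<And>q. q \<in> \<rat> \<Longrightarrow> (LINT s|lebesgue. indicator {..q} s * f s) = 0"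
  shows "AE s in lebesgue. f s = 0"
proof -
  have "f \<in> borel_measurable lebesgue" using f by simp
  then obtain g where g[measurable]: "g \<in> borel_measurable lborel" and "AE s in lborel. f s = g s"
    using completion_ex_borel_measurable_real by blast
  then have fg: "AE s in lebesgue. f s = g s" by (simp add: AE_completion_iff)
  have g': "g \<in> borel_measurable lebesgue" using g by (rule measurable_completion)
  have "integrable lebesgue g"
    using f fg g' by (subst integrable_cong_AE[of g _ f]) (auto elim: eventually_mono)
  then have int: "integrable lborel g" using g by (simp add: integrable_completion)
  have transfer: "(LINT s:S|lborel. g s) = (LINT s|lebesgue. indicator S s * f s)"
    if S: "S \<in> sets borel" for S
  proof -
    have "(LINT s:S|lborel. g s) = (LINT s|lebesgue. indicator S s * g s)"
      unfolding set_lebesgue_integral_def using S by (subst integral_completion) auto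
    also have "\<dots> = (LINT s|lebesgue. indicator S s * f s)"
      using fg g' f borel_measurable_indicator[OF sets_completionI_sets, of S lborel] S
      by (intro integral_cong_AE borel_measurable_times) (auto elim: eventually_mono)
    finally show ?thesis .
  qed
  have g_total: "(LINT s:UNIV|lborel. g s) = 0"
    using transfer[of UNIV] total by simp
  have "(LINT s:S|lborel. g s) = 0" if "S \<in> sets lborel" for S
  proof -
    have S: "S \<in> sigma_sets UNIV ((\<lambda>q. {..q}) ` \<rat>)"
      using that by (simp add: borel_eq_sigma_rational_atMost)
    have stable: "Int_stable ((\<lambda>q::real. {..q}) ` \<rat>)"
      by (auto simp: Int_stable_def min_def)
    have set_int: "set_integrable lborel T g" if "T \<in> sigma_sets UNIV ((\<lambda>q. {..q}) ` \<rat>)" for T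
      unfolding set_integrable_def using int that
      by (intro integrable_mult_indicator) (auto simp: borel_eq_sigma_rational_atMost)
    have sub: "(\<lambda>q::real. {..q}) ` \<rat> \<subseteq> Pow UNIV" by simp
    show ?thesis using stable sub S
    proof (induction rule: sigma_sets_induct_disjoint)
      case (basic T)
      then show ?case using half transfer by auto
    next
      case empty
      then show ?case by (simp add: set_lebesgue_integral_def)
    next
      case (compl T)
      have "(LINT s:T \<union> (UNIV - T)|lborel. g s) = (LINT s:T|lborel. g s) + (LINT s:UNIV - T|lborel. g s)"
        using compl(1) by (intro set_integral_Un set_int) (auto intro: sigma_sets.Compl)
      then show ?case using compl g_total by simp
    next
      case (union T)
      have "(LINT s:(\<Union>i. T i)|lborel. g s) = (\<Sum>i. (LINT s:T i|lborel. g s))"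
        using union(1,2)
        by (intro lebesgue_integral_countable_add set_int sigma_sets.Union)
           (auto simp: disjoint_family_on_def borel_eq_sigma_rational_atMost)
      then show ?case using union(3) by simp
    qed
  qed
  then have "AE s in lborel. g s = 0"
    using int by (intro density_unique_real) auto
  then have "AE s in lebesgue. g s = 0" by (simp add: AE_completion_iff)
  with fg show ?thesis by eventually_elim simp
qed

section \<open>The commutation relation\<close>

text \<open>Integrability is part of the conclusion since the integral of a non-integrable function
  is \<open>0\<close> by default, so that vanishing integrals alone would carry no information.\<close>

lemma commutator_kernel:
  assumes p: "0 \<le> p" and a: "a \<in> borel_measurable lebesgue"
    and A: "A \<in> Lp p \<rightarrow> Lp p" and B: "B \<in> Lp p \<rightarrow> Lp p"
    and A_mult: "\<And>x. x \<in> Lp p \<Longrightarrow> AE t in lebesgue. repr (A x) t = a t * repr x t"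
    and B_kernel: "\<And>x. x \<in> Lp p \<Longrightarrow> AE t in lebesgue.
           integrable (lebesgue_on {\<alpha>..\<beta>}) (\<lambda>s. k (t, s) * repr x s) \<and>
           repr (B x) t = (LINT s|lebesgue_on {\<alpha>..\<beta>}. k (t, s) * repr x s)"
    and x: "x \<in> Lp p"
  shows "AE t in lebesgue.
      integrable (lebesgue_on {\<alpha>..\<beta>}) (\<lambda>s. k (t, s) * (a t - poly F (a s)) * repr x s) \<and>
      repr (A (B x)) t - repr (B (poly_op F A x)) t =
        (LINT s|lebesgue_on {\<alpha>..\<beta>}. k (t, s) * (a t - poly F (a s)) * repr x s)"
proof -
  let ?I = "lebesgue_on {\<alpha>..\<beta>}" and ?y = "poly_op F A x"
  have y: "?y \<in> Lp p" "AE s in lebesgue. repr ?y s = poly F (a s) * repr x s"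
    by (rule poly_op_mult_op[OF p A A_mult x]; assumption)+
  have "B x \<in> Lp p" using B x by auto
  note ABx = A_mult[OF this]
  have y_eq: "AE s in ?I. repr ?y s = poly F (a s) * repr x s"
    using y(2) by (auto simp: AE_restrict_space_iff elim: eventually_mono)
  have pF: "(\<lambda>s. poly F (a s)) \<in> borel_measurable ?I"
    unfolding poly_altdef using a by (intro measurable_restrict_space1) measurable
  show ?thesis
    using ABx B_kernel[OF x] B_kernel[OF y(1)]
  proof eventually_elim
    case (elim t)
    \<comment> \<open>The section \<open>k (t, \<cdot>)\<close> of a Lebesgue measurable \<open>k\<close> need not be measurable, but
      its product with \<open>repr x\<close> is, being integrable; so the factors are regrouped.\<close>
    have "(\<lambda>s. (k (t, s) * repr x s) * poly F (a s)) \<in> borel_measurable ?I"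
      using elim(2) by (intro borel_measurable_times[OF _ pF]) auto
    then have meas: "(\<lambda>s. k (t, s) * poly F (a s) * repr x s) \<in> borel_measurable ?I"
      by (simp add: mult_ac)
    have ae: "AE s in ?I. k (t, s) * repr ?y s = k (t, s) * poly F (a s) * repr x s"
      using y_eq by eventually_elim simp
    have meas': "(\<lambda>s. k (t, s) * repr ?y s) \<in> borel_measurable ?I" using elim(3) by auto
    have int: "integrable ?I (\<lambda>s. k (t, s) * poly F (a s) * repr x s)"
      using elim(3) integrable_cong_AE[OF meas' meas ae] by simp
    have By: "repr (B ?y) t = (LINT s|?I. k (t, s) * poly F (a s) * repr x s)"
      using elim(3) integral_cong_AE[OF meas' meas ae] by simp
    have split: "(\<lambda>s. k (t, s) * (a t - poly F (a s)) * repr x s) =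
        (\<lambda>s. a t * (k (t, s) * repr x s) - k (t, s) * poly F (a s) * repr x s)"
      by (simp add: fun_eq_iff algebra_simps)
    show ?case
      unfolding split using int elim(1,2) By by simp
  qed
qed

theorem proposition3p10:
  fixes p \<alpha> \<beta> :: real
    and a :: "real \<Rightarrow> real" and k :: "real \<times> real \<Rightarrow> real"
    and A B :: "mfun \<Rightarrow> mfun" and F :: "real poly"
  assumes "1 < p" and "\<alpha> < \<beta>"
    and "a \<in> borel_measurable lebesgue"
    and "k \<in> borel_measurable (lebesgue_on (UNIV \<times> {\<alpha>..\<beta>}))"
    and "A \<in> Lp p \<rightarrow> Lp p" and "B \<in> Lp p \<rightarrow> Lp p"
    and "\<And>x. x \<in> Lp p \<Longrightarrow> AE t in lebesgue. repr (A x) t = a t * repr x t"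
    and "\<And>x. x \<in> Lp p \<Longrightarrow> AE t in lebesgue.
           integrable (lebesgue_on {\<alpha>..\<beta>}) (\<lambda>s. k (t, s) * repr x s) \<and>
           repr (B x) t = (LINT s|lebesgue_on {\<alpha>..\<beta>}. k (t, s) * repr x s)"
  shows "(\<forall>x\<in>Lp p. A (B x) = B (poly_op F A x)) \<longleftrightarrow>
    support_on (UNIV \<times> {\<alpha>..\<beta>}) (\<lambda>(t, s). a t - poly F (a s))
      \<inter> support_on (UNIV \<times> {\<alpha>..\<beta>}) k
    \<in> null_sets (lebesgue_on (UNIV \<times> {\<alpha>..\<beta>}))"
proof -
  let ?I = "lebesgue_on {\<alpha>..\<beta>}" and ?strip = "UNIV \<times> {\<alpha>..\<beta>} :: (real \<times> real) set"
  define c where "c t s = k (t, s) * (a t - poly F (a s))" for t s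
  define S where "S = support_on ?strip (\<lambda>(t, s). a t - poly F (a s)) \<inter> support_on ?strip k"
  have not_S: "(t, s) \<notin> S \<longleftrightarrow> (s \<in> {\<alpha>..\<beta>} \<longrightarrow> c t s = 0)" for t s
    by (auto simp: S_def support_on_def c_def)
  have strip: "?strip \<in> sets lebesgue"
    by (intro sets_completionI_sets) (simp add: borel_closed closed_Times)
  have "(\<lambda>z. a (fst z) - poly F (a (snd z))) \<in> borel_measurable lebesgue"
    unfolding poly_altdef
    using measurable_compose[OF measurable_fst_lebesgue assms(3)]
      measurable_compose[OF measurable_snd_lebesgue assms(3)]
    by measurable
  then have "(\<lambda>z. k z * (a (fst z) - poly F (a (snd z)))) \<in> borel_measurable (lebesgue_on ?strip)"
    by (intro borel_measurable_times[OF assms(4) measurable_restrict_space1])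
  then have "{z \<in> space (lebesgue_on ?strip). k z * (a (fst z) - poly F (a (snd z))) \<noteq> 0}
      \<in> sets (lebesgue_on ?strip)"
    by measurable
  also have "{z \<in> space (lebesgue_on ?strip). k z * (a (fst z) - poly F (a (snd z))) \<noteq> 0} = S"
    by (auto simp: S_def support_on_def)
  finally have S_meas: "S \<in> sets lebesgue"
    using strip by (auto simp: sets_restrict_space_iff)
  have "S \<in> null_sets (lebesgue_on ?strip) \<longleftrightarrow> S \<in> null_sets lebesgue"
    using strip by (subst null_sets_restrict_space) (auto simp: S_def support_on_def)
  also have "\<dots> \<longleftrightarrow> (AE t in lebesgue. AE s in lebesgue. (t, s) \<notin> S)"
    by (rule null_set_iff_sections_null[OF S_meas])
  also have "\<dots> \<longleftrightarrow> (AE t in lebesgue. AE s in ?I. c t s = 0)"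
    by (simp add: not_S AE_restrict_space_iff)
  finally have null_iff: "S \<in> null_sets (lebesgue_on ?strip) \<longleftrightarrow>
      (AE t in lebesgue. AE s in ?I. c t s = 0)" .
  have comm: "AE t in lebesgue. integrable ?I (\<lambda>s. c t s * repr x s) \<and>
      repr (A (B x)) t - repr (B (poly_op F A x)) t = (LINT s|?I. c t s * repr x s)"
    if "x \<in> Lp p" for x
    unfolding c_def using assms that by (intro commutator_kernel[where p = p]) auto
  have "(\<forall>x\<in>Lp p. A (B x) = B (poly_op F A x)) \<longleftrightarrow>
      (AE t in lebesgue. AE s in ?I. c t s = 0)"
  proof
    assume null: "AE t in lebesgue. AE s in ?I. c t s = 0"
    show "\<forall>x\<in>Lp p. A (B x) = B (poly_op F A x)"
    proof
      fix x assume "x \<in> Lp p"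
      show "A (B x) = B (poly_op F A x)"
        unfolding mfun_eq_iff using comm[OF \<open>x \<in> Lp p\<close>] null
      proof eventually_elim
        case (elim t)
        have "AE s in ?I. c t s * repr x s = 0"
          using elim(2) by eventually_elim simp
        then have "(LINT s|?I. c t s * repr x s) = 0"
          by (rule integral_eq_zero_AE)
        then show ?case using elim(1) by simp
      qed
    qed
  next
    assume eq: "\<forall>x\<in>Lp p. A (B x) = B (poly_op F A x)"
    define e where "e J = ae_class (indicator J)" for J :: "real set"
    have e_eq: "AE s in ?I. repr (e J) s = indicator J s" if "J \<in> lmeasurable" for J
      unfolding e_def using repr_ae_class[of "indicator J"] that
      by (auto simp: AE_restrict_space_iff elim: eventually_mono)
    have vanish: "AE t in lebesgue. integrable ?I (\<lambda>s. c t s * repr (e J) s) \<and>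
        (LINT s|?I. c t s * repr (e J) s) = 0" if J: "J \<in> lmeasurable" for J
    proof -
      have x: "e J \<in> Lp p" unfolding e_def by (rule indicator_in_Lp[OF J])
      have "AE t in lebesgue. repr (A (B (e J))) t = repr (B (poly_op F A (e J))) t"
        using eq x mfun_eq_iff by blast
      then show ?thesis using comm[OF x] by eventually_elim simp
    qed
    have I_eq: "AE s in ?I. repr (e {\<alpha>..\<beta>}) s = 1"
      using e_eq[of "{\<alpha>..\<beta>}"] by (auto simp: AE_restrict_space_iff elim: eventually_mono)
    \<comment> \<open>Countability of the rationals moves the quantifier inside: one exceptional null set
      of \<open>t\<close> serves for all \<open>q\<close>.\<close>
    have half: "AE t in lebesgue. \<forall>q\<in>\<rat>. integrable ?I (\<lambda>s. c t s * repr (e ({\<alpha>..\<beta>} \<inter> {..q})) s) \<and>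
        (LINT s|?I. c t s * repr (e ({\<alpha>..\<beta>} \<inter> {..q})) s) = 0"
      by (intro AE_ball_countable' vanish countable_rat) (auto intro: fmeasurable_Int_fmeasurable)
    have whole: "AE t in lebesgue. integrable ?I (\<lambda>s. c t s * repr (e {\<alpha>..\<beta>}) s) \<and>
        (LINT s|?I. c t s * repr (e {\<alpha>..\<beta>}) s) = 0"
      by (rule vanish) simp
    show "AE t in lebesgue. AE s in ?I. c t s = 0"
      using half whole
    proof eventually_elim
      case (elim t)
      \<comment> \<open>Almost everywhere on \<open>[\<alpha>,\<beta>]\<close> this is \<open>c t\<close>, but written as a product that is known
        to be integrable.\<close>
      define f where "f = (\<lambda>s. c t s * repr (e {\<alpha>..\<beta>}) s)"
      have f: "integrable ?I f" using elim(2) by (simp add: f_def)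
      have f_int: "(LINT s|?I. indicator {..q} s * f s) = 0" if q: "q \<in> \<rat>" for q
      proof -
        let ?J = "{\<alpha>..\<beta>} \<inter> {..q}"
        have "?J \<in> lmeasurable" by (auto intro: fmeasurable_Int_fmeasurable)
        then have "AE s in ?I. repr (e ?J) s = indicator ?J s" by (rule e_eq)
        moreover have "AE s in ?I. s \<in> {\<alpha>..\<beta>}" by (rule AE_I2) simp
        ultimately have ae: "AE s in ?I. indicator {..q} s * f s = c t s * repr (e ?J) s"
          using I_eq by eventually_elim (auto simp: f_def indicator_def)
        have "indicat_real {..q} \<in> borel_measurable ?I"
          by (intro measurable_restrict_space1 borel_measurable_indicator sets_completionI_sets) simp
        then have "(\<lambda>s. indicator {..q} s * f s) \<in> borel_measurable ?I"
          using f by (intro borel_measurable_times) auto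
        moreover have "(\<lambda>s. c t s * repr (e ?J) s) \<in> borel_measurable ?I"
          using elim(1) q by blast
        ultimately have "(LINT s|?I. indicator {..q} s * f s) = (LINT s|?I. c t s * repr (e ?J) s)"
          using ae by (rule integral_cong_AE)
        then show ?thesis using elim(1) q by simp
      qed
      have "AE s in lebesgue. indicator {\<alpha>..\<beta>} s * f s = 0"
      proof (rule AE_zero_if_integral_atMost_zero)
        show "integrable lebesgue (\<lambda>s. indicator {\<alpha>..\<beta>} s * f s)"
          using f by (simp add: integrable_restrict_space)
        show "(LINT s|lebesgue. indicator {\<alpha>..\<beta>} s * f s) = 0"
          using elim(2) by (simp add: integral_restrict_space f_def)
        show "(LINT s|lebesgue. indicator {..q} s * (indicator {\<alpha>..\<beta>} s * f s)) = 0"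
          if "q \<in> \<rat>" for q
          using f_int[OF that] by (simp add: integral_restrict_space mult.left_commute)
      qed
      then have "AE s in ?I. f s = 0"
        by (auto simp: AE_restrict_space_iff elim: eventually_mono)
      with I_eq show ?case by eventually_elim (simp add: f_def)
    qed
  qed
  then show ?thesis using null_iff by (simp add: S_def)
qed

end
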